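(* Let $\sigma(t)$ be the exact solution of the Duncan–Mortensen–Zakai equation, so that $\sigma(t+\Delta t)=T_{\Delta t}\sigma(t)$ with $T_{\Delta t}=\exp\{(A+B)\Delta t\}$, where $A\sigma=\mathcal{L}^*\sigma$ and $B\sigma=\sigma\,h(x)^\top\dot Y(t)$. Let $S_{\Delta t}^n=\widetilde S_n\,\widetilde T_n$ be the one-step quasi-Monte Carlo operator built from $n$ low-discrepancy samples with star-discrepancy $D^*(n)$. Assume the local truncation error bound $$\|T_{\Delta t}\sigma-S_{\Delta t}^n\sigma\|\le C_1\,\Delta t^2+C_2\,D^*(n)$$ with constants $C_1,C_2>0$ (for $\sigma=\sigma(t)$ along the exact solution), and the stability assumption $\|S_{\Delta t}^n\|\le 1+L\,\Delta t$ for some constant $L>0$. Then there exists $C_3>0$ such that, for $T=K\Delta t$, $$\|\sigma(T)-(S_{\Delta t}^n)^K\sigma(0)\|\le C_3\Bigl(\Delta t+\frac{D^*(n)}{\Delta t}\Bigr).$$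
   Context: Filtering problem: $\mathrm{d}X_t=f(X_t)\,\mathrm{d}t+\mathrm{d}V_t$, $X_0=x_0$, and $\mathrm{d}Y_t=h(X_t)\,\mathrm{d}t+\mathrm{d}W_t$, $Y_0=0$, $t\in[0,T]$, with $f:\mathbb{R}^r\to\mathbb{R}^r$, $h:\mathbb{R}^r\to\mathbb{R}^m$, and $V_t$, $W_t$ independent standard Brownian motions. The unnormalized conditional density $\sigma(x,t)$ solves the Duncan–Mortensen–Zakai (DMZ) equation $$\mathrm{d}\sigma=\mathcal{L}^*\sigma\,\mathrm{d}t+\sigma\,h(x)^\top\mathrm{d}Y_t,\qquad \sigma(x,0)=\sigma_0(x),\qquad \mathcal{L}^*\sigma=\tfrac12\Delta\sigma-\nabla\cdot(f(x)\sigma).$$ $\dot Y(t)$ is the formal time derivative of the observation path; $\Delta Y$ is the observation increment over the time step in question (so the operator $S_{\Delta t}^n$ uses the increment of the current step, and $(S_{\Delta t}^n)^K$ denotes the composition of the $K$ successive steps). Kernel: $$K_{\Delta t}(x,y)=\frac{1}{(2\pi\Delta t)^{r/2}}\exp\Bigl(-\tfrac{\|x-y\|^2}{2\Delta t}-(y-x)\cdot f(x)-\tfrac{\Delta t}{2}\bigl(2\nabla\cdot f(x)+\|f(x)\|^2\bigr)\Bigr).$$ Samples: $\{x_i\}_{i=1}^n\subset\Omega=[-R,R]^r$ is a low-discrepancy point set with star-discrepancy (after rescaling $\Omega$ to the unit cube) $D^*(n)=O((\log n)^r/n)$. Quasi-Monte Carlo operators, for $\phi\in L^\infty(\Omega)$: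 $$(\widetilde T_n\phi)(y)=\frac1n\sum_{i=1}^nK_{\Delta t}(x_i,y)\phi(x_i),\qquad (\widetilde S_n\phi)(y)=\frac1n\sum_{i=1}^n\exp\bigl(h(x_i)^\top\Delta Y-\tfrac12\Delta t\|h(x_i)\|^2\bigr)\phi(x_i),$$ and $S_{\Delta t}^n=\widetilde S_n\widetilde T_n$. Norms: sup norm $\|\phi\|_\infty=\sup_x|\phi(x)|$ for functions and the induced operator norm for operators. *)

theory Defs
  imports "HOL-Probability.Probability" "HOL-Library.Landau_Symbols"
begin

section \<open>Differential operators\<close>

definition partial_deriv :: "'r \<Rightarrow> (real^'r \<Rightarrow> real) \<Rightarrow> real^'r \<Rightarrow> real" where
  "partial_deriv i g x = deriv (\<lambda>s. g (x + s *\<^sub>R axis i 1)) 0"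

definition divergence :: "(real^'r \<Rightarrow> real^'r) \<Rightarrow> real^'r \<Rightarrow> real" where
  "divergence F x = (\<Sum>i\<in>UNIV. partial_deriv i (\<lambda>z. F z $ i) x)"

definition laplacian :: "(real^'r \<Rightarrow> real) \<Rightarrow> real^'r \<Rightarrow> real" where
  "laplacian g x = (\<Sum>i\<in>UNIV. partial_deriv i (partial_deriv i g) x)"

definition C2 :: "(real^'r \<Rightarrow> real) \<Rightarrow> bool" where
  "C2 g \<longleftrightarrow>
     (\<forall>x. g differentiable (at x)) \<and>
     (\<forall>i x. partial_deriv i g differentiable (at x)) \<and>
     (\<forall>i j. continuous_on UNIV (partial_deriv j (partial_deriv i g)))"

definition dual_generator ::
  "(real^'r \<Rightarrow> real^'r) \<Rightarrow> (real^'r \<Rightarrow> real) \<Rightarrow> real^'r \<Rightarrow> real" where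
  "dual_generator f \<phi> x = laplacian \<phi> x / 2 - divergence (\<lambda>z. \<phi> z *\<^sub>R f z) x"

section \<open>The filtering problem\<close>

definition brownian_motion :: "'w measure \<Rightarrow> real \<Rightarrow> (real \<Rightarrow> 'w \<Rightarrow> real^'d) \<Rightarrow> bool" where
  "brownian_motion M T B \<longleftrightarrow>
     (\<forall>t\<in>{0..T}. B t \<in> borel_measurable M) \<and>
     (AE \<omega> in M. B 0 \<omega> = 0) \<and>
     (AE \<omega> in M. continuous_on {0..T} (\<lambda>t. B t \<omega>)) \<and>
     (\<forall>s t. 0 \<le> s \<and> s < t \<and> t \<le> T \<longrightarrow>
        (\<forall>j. distributed M lborel (\<lambda>\<omega>. (B t \<omega> - B s \<omega>) $ j) (normal_density 0 (sqrt (t - s)))) \<and>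
        prob_space.indep_vars M (\<lambda>_. borel) (\<lambda>j \<omega>. (B t \<omega> - B s \<omega>) $ j) UNIV) \<and>
     (\<forall>(k::nat) u. (\<forall>i\<le>k. u i \<in> {0..T}) \<and> (\<forall>i<k. u i \<le> u (Suc i)) \<longrightarrow>
        prob_space.indep_vars M (\<lambda>_. borel) (\<lambda>i \<omega>. B (u (Suc i)) \<omega> - B (u i) \<omega>) {..<k})"

text \<open>The library's \<open>indep_var\<close> requires both maps to have the same value type.\<close>

definition indep_maps ::
  "'w measure \<Rightarrow> 'a measure \<Rightarrow> ('w \<Rightarrow> 'a) \<Rightarrow> 'b measure \<Rightarrow> ('w \<Rightarrow> 'b) \<Rightarrow> bool" where
  "indep_maps M A F B G \<longleftrightarrow>
     F \<in> measurable M A \<and> G \<in> measurable M B \<and>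
     prob_space.indep_set M {F -` S \<inter> space M | S. S \<in> sets A} {G -` S \<inter> space M | S. S \<in> sets B}"

text \<open>The initial state may be random; the two independence conditions together say that
  \<open>x0\<close>, \<open>V\<close> and \<open>W\<close> are mutually independent.\<close>

definition filtering_model ::
  "'w measure \<Rightarrow> real \<Rightarrow> (real^'r \<Rightarrow> real^'r) \<Rightarrow> (real^'r \<Rightarrow> real^'m) \<Rightarrow> ('w \<Rightarrow> real^'r) \<Rightarrow>
   (real \<Rightarrow> 'w \<Rightarrow> real^'r) \<Rightarrow> (real \<Rightarrow> 'w \<Rightarrow> real^'m) \<Rightarrow>
   (real \<Rightarrow> 'w \<Rightarrow> real^'r) \<Rightarrow> (real \<Rightarrow> 'w \<Rightarrow> real^'m) \<Rightarrow> bool" where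
  "filtering_model M T f h x0 V W X Y \<longleftrightarrow>
     prob_space M \<and> brownian_motion M T V \<and> brownian_motion M T W \<and>
     indep_maps M
       (Pi\<^sub>M {0..T} (\<lambda>_. borel)) (\<lambda>\<omega>. \<lambda>t\<in>{0..T}. V t \<omega>)
       (Pi\<^sub>M {0..T} (\<lambda>_. borel)) (\<lambda>\<omega>. \<lambda>t\<in>{0..T}. W t \<omega>) \<and>
     indep_maps M
       borel x0
       (Pi\<^sub>M {0..T} (\<lambda>_. borel \<Otimes>\<^sub>M borel)) (\<lambda>\<omega>. \<lambda>t\<in>{0..T}. (V t \<omega>, W t \<omega>)) \<and>
     (\<forall>t\<in>{0..T}. X t \<in> borel_measurable M \<and> Y t \<in> borel_measurable M) \<and>
     (AE \<omega> in M. \<forall>t\<in>{0..T}.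
        (\<lambda>s. f (X s \<omega>)) absolutely_integrable_on {0..t} \<and>
        X t \<omega> = x0 \<omega> + integral {0..t} (\<lambda>s. f (X s \<omega>)) + V t \<omega>) \<and>
     (AE \<omega> in M. \<forall>t\<in>{0..T}.
        (\<lambda>s. h (X s \<omega>)) absolutely_integrable_on {0..t} \<and>
        Y t \<omega> = integral {0..t} (\<lambda>s. h (X s \<omega>)) + W t \<omega>)"

section \<open>The Duncan--Mortensen--Zakai equation\<close>

text \<open>\<open>I\<close> is a version of the Ito integral of \<open>H\<close> against \<open>Y\<close> over \<open>[a, b]\<close>, as the
  limit in probability of the left-endpoint sums. This is the Ito integral for continuous
  adapted \<open>H\<close> and a continuous semimartingale \<open>Y\<close>, the only case used below.\<close>

definition has_ito_integral ::
  "'w measure \<Rightarrow> (real \<Rightarrow> 'w \<Rightarrow> 'e::euclidean_space) \<Rightarrow> (real \<Rightarrow> 'w \<Rightarrow> 'e) \<Rightarrow>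
   real \<Rightarrow> real \<Rightarrow> ('w \<Rightarrow> real) \<Rightarrow> bool" where
  "has_ito_integral M H Y a b I \<longleftrightarrow>
     I \<in> borel_measurable M \<and>
     (\<forall>\<epsilon>>0. (\<lambda>N::nat. measure M {\<omega> \<in> space M.
        \<epsilon> < \<bar>(\<Sum>k<N. H (a + real k * (b - a) / real N) \<omega> \<bullet>
               (Y (a + real (Suc k) * (b - a) / real N) \<omega> - Y (a + real k * (b - a) / real N) \<omega>))
             - I \<omega>\<bar>}) \<longlonglongrightarrow> 0)"

text \<open>Measurability of \<open>Z\<close> with respect to the completion of the sigma-algebra generated by
  \<open>Y s\<close>, \<open>0 \<le> s \<le> t\<close>.\<close>

definition observed_by ::
  "'w measure \<Rightarrow> (real \<Rightarrow> 'w \<Rightarrow> 'e::euclidean_space) \<Rightarrow> real \<Rightarrow> ('w \<Rightarrow> real) \<Rightarrow> bool" where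
  "observed_by M Y t Z \<longleftrightarrow>
     Z \<in> borel_measurable M \<and>
     (\<exists>g \<in> borel_measurable (Pi\<^sub>M {0..t} (\<lambda>_. borel)).
        AE \<omega> in M. Z \<omega> = g (\<lambda>s\<in>{0..t}. Y s \<omega>))"

text \<open>Classical solutions on \<open>[a, b]\<close>, written \<open>\<rho> t \<omega> x\<close>. The equation
  \<open>d\<rho> = L* \<rho> dt + \<rho> h(x)\<^sup>T dY\<close> is imposed in integrated form over every \<open>[s, t]\<close>
  contained in \<open>[a, b]\<close>, for every \<open>x\<close>.\<close>

definition dmz_solution ::
  "'w measure \<Rightarrow> (real^'r \<Rightarrow> real^'r) \<Rightarrow> (real^'r \<Rightarrow> real^'m) \<Rightarrow> (real \<Rightarrow> 'w \<Rightarrow> real^'m) \<Rightarrow>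
   real \<Rightarrow> real \<Rightarrow> (real \<Rightarrow> 'w \<Rightarrow> real^'r \<Rightarrow> real) \<Rightarrow> bool" where
  "dmz_solution M f h Y a b \<rho> \<longleftrightarrow>
     (\<forall>t\<in>{a..b}. \<forall>x. observed_by M Y t (\<lambda>\<omega>. \<rho> t \<omega> x)) \<and>
     (AE \<omega> in M. \<forall>t\<in>{a..b}. C2 (\<rho> t \<omega>)) \<and>
     (AE \<omega> in M. \<forall>x. continuous_on {a..b} (\<lambda>t. \<rho> t \<omega> x)) \<and>
     (AE \<omega> in M. \<forall>x. (\<lambda>t. dual_generator f (\<rho> t \<omega>) x) absolutely_integrable_on {a..b}) \<and>
     (\<forall>s t x. a \<le> s \<and> s \<le> t \<and> t \<le> b \<longrightarrow>
        (\<exists>I. has_ito_integral M (\<lambda>u \<omega>. \<rho> u \<omega> x *\<^sub>R h x) Y s t I \<and>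
             (AE \<omega> in M. \<rho> t \<omega> x =
                \<rho> s \<omega> x + integral {s..t} (\<lambda>u. dual_generator f (\<rho> u \<omega>) x) + I \<omega>)))"

text \<open>The meaning given to the formal exponential \<open>exp {(A + B) \<Delta>t}\<close>, where \<open>A = L*\<close> and \<open>B\<close>
  is multiplication by \<open>h\<^sup>T dY/dt\<close>: the solution operator of the equation.
  \<open>P \<omega> t \<Delta>t\<close> maps the state at time \<open>t\<close> to the state at time \<open>t + \<Delta>t\<close>, for the
  realized observation path \<open>Y \<omega>\<close>. Already the heat equation (\<open>f = 0\<close>, \<open>h = 0\<close>) has
  nonunique classical solutions without a growth condition, so the state space \<open>D\<close> on which
  \<open>P\<close> propagates solutions is a parameter.\<close>

definition dmz_propagator ::
  "'w measure \<Rightarrow> (real^'r \<Rightarrow> real^'r) \<Rightarrow> (real^'r \<Rightarrow> real^'m) \<Rightarrow> (real \<Rightarrow> 'w \<Rightarrow> real^'m) \<Rightarrow>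
   real \<Rightarrow> (real^'r \<Rightarrow> real) set \<Rightarrow>
   ('w \<Rightarrow> real \<Rightarrow> real \<Rightarrow> (real^'r \<Rightarrow> real) \<Rightarrow> real^'r \<Rightarrow> real) \<Rightarrow> bool" where
  "dmz_propagator M f h Y T D P \<longleftrightarrow>
     (\<forall>a b \<rho>. 0 \<le> a \<and> a \<le> b \<and> b \<le> T \<and> dmz_solution M f h Y a b \<rho> \<and>
        (AE \<omega> in M. \<forall>t\<in>{a..b}. \<rho> t \<omega> \<in> D) \<longrightarrow>
        (AE \<omega> in M. \<rho> b \<omega> = P \<omega> a (b - a) (\<rho> a \<omega>)))"

section \<open>Samples and discrepancy\<close>

definition Omega :: "real \<Rightarrow> (real^'r) set" where
  "Omega R = cbox (\<chi> i. - R) (\<chi> i. R)"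

definition to_unit_cube :: "real \<Rightarrow> real^'r \<Rightarrow> real^'r" where
  "to_unit_cube R z = (\<chi> i. (z $ i + R) / (2 * R))"

definition star_discrepancy :: "nat \<Rightarrow> (nat \<Rightarrow> real^'r) \<Rightarrow> real" where
  "star_discrepancy n p =
     (SUP u \<in> cbox 0 (\<chi> i. 1).
        \<bar>real (card {i \<in> {1..n}. \<forall>j. 0 \<le> p i $ j \<and> p i $ j < u $ j}) / real n
           - (\<Prod>j\<in>UNIV. u $ j)\<bar>)"

definition sample_discrepancy :: "real \<Rightarrow> nat \<Rightarrow> (nat \<Rightarrow> real^'r) \<Rightarrow> real" where
  "sample_discrepancy R n p = star_discrepancy n (\<lambda>i. to_unit_cube R (p i))"

section \<open>Norms\<close>

text \<open>The operators evaluate functions at points, so elements of \<open>L\<^sup>\<infinity>\<close> are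
  bounded measurable functions on \<open>Omega R\<close>, not classes modulo null sets.\<close>

definition Linf :: "real \<Rightarrow> (real^'r \<Rightarrow> real) set" where
  "Linf R = {\<phi> \<in> borel_measurable (lebesgue_on (Omega R)). bounded (\<phi> ` Omega R)}"

definition sup_norm :: "real \<Rightarrow> (real^'r \<Rightarrow> real) \<Rightarrow> real" where
  "sup_norm R \<phi> = (SUP x \<in> Omega R. \<bar>\<phi> x\<bar>)"

definition op_norm :: "real \<Rightarrow> ((real^'r \<Rightarrow> real) \<Rightarrow> real^'r \<Rightarrow> real) \<Rightarrow> real" where
  "op_norm R S = (SUP \<phi> \<in> {\<phi> \<in> Linf R. sup_norm R \<phi> \<le> 1}. sup_norm R (S \<phi>))"

section \<open>The quasi-Monte Carlo scheme\<close>

definition kernel :: "(real^'r \<Rightarrow> real^'r) \<Rightarrow> real \<Rightarrow> real^'r \<Rightarrow> real^'r \<Rightarrow> real" where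
  "kernel f dt x y =
     1 / (2 * pi * dt) powr (real CARD('r) / 2) *
     exp (- (norm (x - y))\<^sup>2 / (2 * dt) - (y - x) \<bullet> f x
          - dt / 2 * (2 * divergence f x + (norm (f x))\<^sup>2))"

definition T_qmc ::
  "(real^'r \<Rightarrow> real^'r) \<Rightarrow> real \<Rightarrow> nat \<Rightarrow> (nat \<Rightarrow> real^'r) \<Rightarrow>
   (real^'r \<Rightarrow> real) \<Rightarrow> real^'r \<Rightarrow> real" where
  "T_qmc f dt n p \<phi> y = 1 / real n * (\<Sum>i=1..n. kernel f dt (p i) y * \<phi> (p i))"

text \<open>The value does not depend on \<open>y\<close>: the observation weight is evaluated at the samples.\<close>

definition S_qmc ::
  "(real^'r \<Rightarrow> real^'m) \<Rightarrow> real \<Rightarrow> real^'m \<Rightarrow> nat \<Rightarrow> (nat \<Rightarrow> real^'r) \<Rightarrow>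
   (real^'r \<Rightarrow> real) \<Rightarrow> real^'r \<Rightarrow> real" where
  "S_qmc h dt dY n p \<phi> y =
     1 / real n * (\<Sum>i=1..n. exp (h (p i) \<bullet> dY - dt / 2 * (norm (h (p i)))\<^sup>2) * \<phi> (p i))"

definition qmc_step ::
  "(real^'r \<Rightarrow> real^'r) \<Rightarrow> (real^'r \<Rightarrow> real^'m) \<Rightarrow> real \<Rightarrow> real^'m \<Rightarrow> nat \<Rightarrow> (nat \<Rightarrow> real^'r) \<Rightarrow>
   (real^'r \<Rightarrow> real) \<Rightarrow> real^'r \<Rightarrow> real" where
  "qmc_step f h dt dY n p = S_qmc h dt dY n p \<circ> T_qmc f dt n p"

definition increment :: "(real \<Rightarrow> real^'m) \<Rightarrow> real \<Rightarrow> nat \<Rightarrow> real^'m" where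
  "increment y dt k = y (real (Suc k) * dt) - y (real k * dt)"

text \<open>The composition of the first \<open>K\<close> steps along the observation path \<open>y\<close>.\<close>

primrec qmc_iterate ::
  "(real^'r \<Rightarrow> real^'r) \<Rightarrow> (real^'r \<Rightarrow> real^'m) \<Rightarrow> real \<Rightarrow> (real \<Rightarrow> real^'m) \<Rightarrow>
   nat \<Rightarrow> (nat \<Rightarrow> real^'r) \<Rightarrow> nat \<Rightarrow> (real^'r \<Rightarrow> real) \<Rightarrow> real^'r \<Rightarrow> real" where
  "qmc_iterate f h dt y n p 0 = id"
| "qmc_iterate f h dt y n p (Suc k) =
     qmc_step f h dt (increment y dt k) n p \<circ> qmc_iterate f h dt y n p k"

end

theory Submission
  imports Defs
begin

text \<open>The global error obeys a discrete Gronwall inequality. Write \<open>e\<^sub>k\<close> for the difference at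
  time \<open>k \<Delta>t\<close> between the exact solution \<open>\<sigma>\<close> and the \<open>k\<close>-fold composition of the scheme, and
  \<open>S\<^sub>k\<close> for the \<open>k\<close>-th step. Almost surely \<open>P\<close> carries \<open>\<sigma>\<close> from each grid point to the next, so
  \<open>e\<^sub>k\<^sub>+\<^sub>1\<close> is the sum of the local error \<open>P \<sigma>(k \<Delta>t) - S\<^sub>k \<sigma>(k \<Delta>t)\<close> and, by linearity, of
  \<open>S\<^sub>k e\<^sub>k\<close>. The truncation bound \<open>\<tau> = C1 \<Delta>t\<^sup>2 + C2 D*(n)\<close> and the stability assumption give
  \<open>\<parallel>e\<^sub>k\<^sub>+\<^sub>1\<parallel> \<le> \<tau> + (1 + L \<Delta>t) \<parallel>e\<^sub>k\<parallel>\<close> with \<open>e\<^sub>0 = 0\<close>, hence \<open>\<parallel>e\<^sub>K\<parallel> \<le> K \<tau> exp (L K \<Delta>t)\<close>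
  (lemma \<open>discrete_gronwall\<close>). Since \<open>K = T / \<Delta>t\<close>, the constant
  \<open>C3 = T exp (L T) max C1 C2\<close> works.

  Because \<open>sup_norm\<close> and \<open>op_norm\<close> are real suprema, they are meaningful only for bounded
  families. The norm inequalities therefore use that almost every path of \<open>\<sigma>\<close> is continuous in
  space, so bounded on the compact cube, and that a step is a finite weighted sum of point values
  in the cube (lemma \<open>qmc_step_bounded\<close>).

  The exceptional null set must not depend on the step size. As \<open>\<Delta>t = T / K\<close>, only
  countably many grid points occur, and the propagator identity holds at all of them
  simultaneously (lemma \<open>propagator_on_grids\<close>).\<close>

section \<open>Supremum and operator norms\<close>

lemma Omega_nonempty:
  assumes "R > 0"
  shows "(Omega R :: (real^'r) set) \<noteq> {}"
proof -
  have "(0 :: real^'r) \<in> Omega R"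
    using assms by (simp add: Omega_def mem_box_cart)
  then show ?thesis by blast
qed

lemma bdd_above_abs:
  fixes \<phi> :: "real^'r \<Rightarrow> real"
  assumes "bounded (\<phi> ` Omega R)"
  shows "bdd_above ((\<lambda>z. \<bar>\<phi> z\<bar>) ` Omega R)"
proof -
  obtain B where "\<forall>z\<in>Omega R. \<bar>\<phi> z\<bar> \<le> B"
    using assms by (auto simp: bounded_iff)
  then show ?thesis by (intro bdd_aboveI2[where M = B]) auto
qed

lemma abs_le_sup_norm:
  assumes "bounded (\<phi> ` Omega R)" and "z \<in> Omega R"
  shows "\<bar>\<phi> z\<bar> \<le> sup_norm R \<phi>"
  unfolding sup_norm_def using assms by (intro cSUP_upper bdd_above_abs)

lemma sup_norm_le:
  fixes \<phi> :: "real^'r \<Rightarrow> real"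
  assumes "R > 0" and "\<And>z. z \<in> Omega R \<Longrightarrow> \<bar>\<phi> z\<bar> \<le> c"
  shows "sup_norm R \<phi> \<le> c"
  unfolding sup_norm_def using assms by (intro cSUP_least Omega_nonempty)

lemma sup_norm_nonneg:
  fixes \<phi> :: "real^'r \<Rightarrow> real"
  assumes "R > 0" and "bounded (\<phi> ` Omega R)"
  shows "0 \<le> sup_norm R \<phi>"
proof -
  obtain z :: "real^'r" where "z \<in> Omega R"
    using Omega_nonempty[OF \<open>R > 0\<close>] by blast
  from abs_le_sup_norm[OF assms(2) this] show ?thesis by linarith
qed

lemma sup_norm_add_le:
  fixes \<phi> \<psi> :: "real^'r \<Rightarrow> real"
  assumes "R > 0" and "bounded (\<phi> ` Omega R)" and "bounded (\<psi> ` Omega R)"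
  shows "sup_norm R (\<lambda>z. \<phi> z + \<psi> z) \<le> sup_norm R \<phi> + sup_norm R \<psi>"
  by (rule sup_norm_le[OF \<open>R > 0\<close>])
     (use abs_le_sup_norm[OF assms(2)] abs_le_sup_norm[OF assms(3)] in fastforce)

lemma sup_norm_scale_le:
  fixes \<phi> :: "real^'r \<Rightarrow> real"
  assumes "R > 0" and "bounded (\<phi> ` Omega R)"
  shows "sup_norm R (\<lambda>z. c * \<phi> z) \<le> \<bar>c\<bar> * sup_norm R \<phi>"
  by (rule sup_norm_le[OF \<open>R > 0\<close>])
     (simp add: abs_mult mult_left_mono abs_le_sup_norm[OF assms(2)])

lemma Linf_scale:
  assumes "\<phi> \<in> Linf R"
  shows "(\<lambda>z. c * \<phi> z) \<in> Linf R"
proof -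
  have "bounded ((\<lambda>y. c * y) ` (\<phi> ` Omega R))"
    using assms bounded_scaling[of "\<phi> ` Omega R" c] by (simp add: Linf_def)
  moreover have "(\<lambda>z. c * \<phi> z) \<in> borel_measurable (lebesgue_on (Omega R))"
    using assms by (intro borel_measurable_times borel_measurable_const) (simp add: Linf_def)
  ultimately show ?thesis by (simp add: Linf_def image_image)
qed

lemma continuous_on_imp_Linf:
  fixes \<phi> :: "real^'r \<Rightarrow> real"
  assumes "continuous_on (Omega R) \<phi>"
  shows "\<phi> \<in> Linf R"
proof -
  have "bounded (\<phi> ` Omega R)"
    using assms by (intro compact_imp_bounded compact_continuous_image) (simp_all add: Omega_def)
  moreover have "\<phi> \<in> borel_measurable (lebesgue_on (Omega R))"
    using assms by (intro continuous_imp_measurable_on_sets_lebesgue) (simp_all add: Omega_def)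
  ultimately show ?thesis by (simp add: Linf_def)
qed

text \<open>The boundedness hypothesis is essential: it makes the set over which \<open>op_norm\<close> takes its
  supremum bounded above.\<close>

lemma sup_norm_le_op_norm:
  fixes S :: "(real^'r \<Rightarrow> real) \<Rightarrow> real^'r \<Rightarrow> real"
  assumes "R > 0"
    and scale: "\<And>c \<phi>. S (\<lambda>z. c * \<phi> z) = (\<lambda>z. c * S \<phi> z)"
    and bound: "\<And>\<phi> z. \<phi> \<in> Linf R \<Longrightarrow> \<bar>S \<phi> z\<bar> \<le> B * sup_norm R \<phi>"
    and \<phi>: "\<phi> \<in> Linf R"
  shows "sup_norm R (S \<phi>) \<le> op_norm R S * sup_norm R \<phi>"
proof (cases "sup_norm R \<phi> = 0")
  case True
  then show ?thesis
    using bound[OF \<phi>] by (intro sup_norm_le[OF \<open>R > 0\<close>]) auto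
next
  case False
  have bounded: "bounded (\<psi> ` Omega R)" if "\<psi> \<in> Linf R" for \<psi> :: "real^'r \<Rightarrow> real"
    using that by (simp add: Linf_def)
  define s where "s = sup_norm R \<phi>"
  have "s > 0"
    using False sup_norm_nonneg[OF \<open>R > 0\<close> bounded[OF \<phi>]] by (simp add: s_def)
  define \<psi> where "\<psi> = (\<lambda>z. (1 / s) * \<phi> z)"
  have \<psi>: "\<psi> \<in> Linf R"
    unfolding \<psi>_def by (rule Linf_scale[OF \<phi>])
  have "sup_norm R \<psi> \<le> \<bar>1 / s\<bar> * sup_norm R \<phi>"
    unfolding \<psi>_def by (rule sup_norm_scale_le[OF \<open>R > 0\<close> bounded[OF \<phi>]])
  also have "\<dots> = 1"
    using \<open>s > 0\<close> by (simp add: s_def[symmetric])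
  finally have \<psi>_le: "sup_norm R \<psi> \<le> 1" .
  have "sup_norm R (S \<eta>) \<le> \<bar>B\<bar>" if "\<eta> \<in> Linf R" "sup_norm R \<eta> \<le> 1" for \<eta>
  proof (rule sup_norm_le[OF \<open>R > 0\<close>])
    fix z :: "real^'r"
    have "\<bar>S \<eta> z\<bar> \<le> B * sup_norm R \<eta>" by (rule bound[OF that(1)])
    also have "\<dots> \<le> \<bar>B\<bar> * sup_norm R \<eta>"
      using sup_norm_nonneg[OF \<open>R > 0\<close> bounded[OF that(1)]] by (intro mult_right_mono) auto
    also have "\<dots> \<le> \<bar>B\<bar>"
      using mult_left_mono[OF that(2), of "\<bar>B\<bar>"] by simp
    finally show "\<bar>S \<eta> z\<bar> \<le> \<bar>B\<bar>" .
  qed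
  then have "bdd_above ((\<lambda>\<eta>. sup_norm R (S \<eta>)) ` {\<eta> \<in> Linf R. sup_norm R \<eta> \<le> 1})"
    by (intro bdd_aboveI2) auto
  then have op: "sup_norm R (S \<psi>) \<le> op_norm R S"
    unfolding op_norm_def using \<psi> \<psi>_le by (intro cSUP_upper) auto
  have "bounded (S \<psi> ` Omega R)"
    using bound[OF \<psi>] by (auto simp: bounded_iff)
  then have "sup_norm R (\<lambda>z. s * S \<psi> z) \<le> \<bar>s\<bar> * sup_norm R (S \<psi>)"
    by (rule sup_norm_scale_le[OF \<open>R > 0\<close>])
  moreover have "S \<phi> = (\<lambda>z. s * S \<psi> z)"
    using scale[of s \<psi>] \<open>s > 0\<close> by (simp add: \<psi>_def)
  ultimately have "sup_norm R (S \<phi>) \<le> s * sup_norm R (S \<psi>)"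
    using \<open>s > 0\<close> by simp
  also have "\<dots> \<le> s * op_norm R S"
    using op \<open>s > 0\<close> by simp
  finally show ?thesis by (simp add: s_def mult.commute)
qed

section \<open>The quasi-Monte Carlo step\<close>

lemma qmc_step_scale:
  "qmc_step f h dt dY n p (\<lambda>z. c * \<phi> z) = (\<lambda>z. c * qmc_step f h dt dY n p \<phi> z)"
proof -
  have "T_qmc f dt n p (\<lambda>z. c * \<phi> z) = (\<lambda>y. c * T_qmc f dt n p \<phi> y)"
    by (rule ext) (simp add: T_qmc_def sum_distrib_left mult_ac)
  then show ?thesis
    by (simp add: fun_eq_iff qmc_step_def S_qmc_def sum_distrib_left mult_ac)
qed

lemma qmc_step_diff:
  "qmc_step f h dt dY n p (\<lambda>z. \<phi> z - \<psi> z)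
     = (\<lambda>z. qmc_step f h dt dY n p \<phi> z - qmc_step f h dt dY n p \<psi> z)"
proof -
  have "T_qmc f dt n p (\<lambda>z. \<phi> z - \<psi> z) = (\<lambda>y. T_qmc f dt n p \<phi> y - T_qmc f dt n p \<psi> y)"
    by (rule ext) (simp add: T_qmc_def sum_subtractf right_diff_distrib diff_divide_distrib)
  then show ?thesis
    by (simp add: fun_eq_iff qmc_step_def S_qmc_def sum_subtractf right_diff_distrib
        diff_divide_distrib)
qed

lemma qmc_step_eq_const: "qmc_step f h dt dY n p \<phi> = (\<lambda>_. qmc_step f h dt dY n p \<phi> 0)"
  by (rule ext) (simp add: qmc_step_def S_qmc_def)

lemma qmc_step_bounded:
  fixes p :: "nat \<Rightarrow> real^'r"
  assumes samples: "\<And>i. i \<in> {1..n} \<Longrightarrow> p i \<in> Omega R"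
  obtains B where
    "\<And>\<phi> z. \<phi> \<in> Linf R \<Longrightarrow> \<bar>qmc_step f h dt dY n p \<phi> z\<bar> \<le> B * sup_norm R \<phi>"
proof
  define w where "w i = exp (h (p i) \<bullet> dY - dt / 2 * (norm (h (p i)))\<^sup>2)" for i
  define B where "B = 1 / real n * (\<Sum>i=1..n. w i *
     (1 / real n * (\<Sum>j=1..n. \<bar>kernel f dt (p j) (p i)\<bar>)))"
  fix \<phi> :: "real^'r \<Rightarrow> real" and z
  assume "\<phi> \<in> Linf R"
  then have \<phi>: "\<bar>\<phi> (p j)\<bar> \<le> sup_norm R \<phi>" if "j \<in> {1..n}" for j
    using samples[OF that] by (intro abs_le_sup_norm) (auto simp: Linf_def)
  have T: "\<bar>T_qmc f dt n p \<phi> y\<bar>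
      \<le> 1 / real n * (\<Sum>j=1..n. \<bar>kernel f dt (p j) y\<bar>) * sup_norm R \<phi>" for y
  proof -
    have "\<bar>\<Sum>j=1..n. kernel f dt (p j) y * \<phi> (p j)\<bar>
        \<le> (\<Sum>j=1..n. \<bar>kernel f dt (p j) y\<bar> * sup_norm R \<phi>)"
      by (rule order_trans[OF sum_abs])
         (auto simp: abs_mult intro!: sum_mono mult_left_mono \<phi>)
    then have "1 / real n * \<bar>\<Sum>j=1..n. kernel f dt (p j) y * \<phi> (p j)\<bar>
        \<le> 1 / real n * (\<Sum>j=1..n. \<bar>kernel f dt (p j) y\<bar> * sup_norm R \<phi>)"
      by (intro mult_left_mono) auto
    then show ?thesis
      by (simp add: T_qmc_def abs_mult sum_distrib_right)
  qed
  have "\<bar>\<Sum>i=1..n. w i * T_qmc f dt n p \<phi> (p i)\<bar>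
      \<le> (\<Sum>i=1..n. w i *
            (1 / real n * (\<Sum>j=1..n. \<bar>kernel f dt (p j) (p i)\<bar>) * sup_norm R \<phi>))"
  proof (rule order_trans[OF sum_abs], rule sum_mono)
    fix i
    have "0 \<le> w i" by (simp add: w_def)
    with mult_left_mono[OF T[of "p i"] this]
    show "\<bar>w i * T_qmc f dt n p \<phi> (p i)\<bar>
        \<le> w i * (1 / real n * (\<Sum>j=1..n. \<bar>kernel f dt (p j) (p i)\<bar>) * sup_norm R \<phi>)"
      by (simp only: abs_mult abs_of_nonneg)
  qed
  then have "1 / real n * \<bar>\<Sum>i=1..n. w i * T_qmc f dt n p \<phi> (p i)\<bar>
      \<le> 1 / real n * (\<Sum>i=1..n. w i *
            (1 / real n * (\<Sum>j=1..n. \<bar>kernel f dt (p j) (p i)\<bar>) * sup_norm R \<phi>))"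
    by (intro mult_left_mono) auto
  also have "\<dots> = B * sup_norm R \<phi>"
    by (simp only: B_def sum_distrib_right mult.assoc)
  finally show "\<bar>qmc_step f h dt dY n p \<phi> z\<bar> \<le> B * sup_norm R \<phi>"
    by (simp add: qmc_step_def S_qmc_def w_def abs_mult)
qed

lemma sup_norm_qmc_step_le:
  fixes p :: "nat \<Rightarrow> real^'r"
  assumes "R > 0" and "\<And>i. i \<in> {1..n} \<Longrightarrow> p i \<in> Omega R" and "\<phi> \<in> Linf R"
  shows "sup_norm R (qmc_step f h dt dY n p \<phi>)
    \<le> op_norm R (qmc_step f h dt dY n p) * sup_norm R \<phi>"
proof -
  obtain B where
    "\<And>\<phi> z. \<phi> \<in> Linf R \<Longrightarrow> \<bar>qmc_step f h dt dY n p \<phi> z\<bar> \<le> B * sup_norm R \<phi>"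
    using qmc_step_bounded assms(2) by blast
  from sup_norm_le_op_norm[OF \<open>R > 0\<close> qmc_step_scale this assms(3)] show ?thesis .
qed

lemma continuous_on_qmc_step: "continuous_on A (qmc_step f h dt dY n p \<phi>)"
  by (subst qmc_step_eq_const) (rule continuous_on_const)

lemma continuous_on_qmc_iterate:
  assumes "continuous_on A \<phi>"
  shows "continuous_on A (qmc_iterate f h dt y n p k \<phi>)"
  using assms by (cases k) (simp_all add: continuous_on_qmc_step)

section \<open>Star discrepancy\<close>

text \<open>The empirical and the true volume of a box lie in \<open>[0, 1]\<close>, so the supremum that defines
  the discrepancy is over a bounded set.\<close>

lemma star_discrepancy_nonneg: "0 \<le> star_discrepancy n (p :: nat \<Rightarrow> real^'r)"
proof -
  let ?C = "cbox 0 (\<chi> i. 1) :: (real^'r) set"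
  let ?c = "\<lambda>u :: real^'r. real (card {i \<in> {1..n}. \<forall>j. 0 \<le> p i $ j \<and> p i $ j < u $ j}) / real n"
  let ?g = "\<lambda>u :: real^'r. \<bar>?c u - (\<Prod>j\<in>UNIV. u $ j)\<bar>"
  have "?g u \<le> 1" if "u \<in> ?C" for u
  proof -
    have "card {i \<in> {1..n}. \<forall>j. 0 \<le> p i $ j \<and> p i $ j < u $ j} \<le> card {1..n}"
      by (intro card_mono) auto
    then have "?c u \<le> 1"
      by (auto simp: divide_le_eq_1)
    moreover have "0 \<le> ?c u" by simp
    moreover have "0 \<le> (\<Prod>j\<in>UNIV. u $ j)" "(\<Prod>j\<in>UNIV. u $ j) \<le> 1"
      using that by (auto simp: mem_box_cart intro!: prod_nonneg prod_le_1)
    ultimately show ?thesis by linarith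
  qed
  then have "bdd_above (?g ` ?C)" by (intro bdd_aboveI2)
  moreover have "0 \<in> ?C" by (simp add: mem_box_cart)
  ultimately have "?g 0 \<le> (SUP u\<in>?C. ?g u)" by (intro cSUP_upper)
  then show ?thesis unfolding star_discrepancy_def by linarith
qed

section \<open>Exact propagation along the time grids\<close>

lemma dmz_solution_subinterval:
  assumes sol: "dmz_solution M f h Y a b \<rho>" and "a \<le> a'" and "b' \<le> b"
  shows "dmz_solution M f h Y a' b' \<rho>"
proof -
  have sub: "{a'..b'} \<subseteq> {a..b}" using assms by auto
  have "\<forall>t\<in>{a'..b'}. \<forall>x. observed_by M Y t (\<lambda>\<omega>. \<rho> t \<omega> x)"
    using sol sub unfolding dmz_solution_def by blast
  moreover have "AE \<omega> in M. \<forall>t\<in>{a'..b'}. C2 (\<rho> t \<omega>)"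
  proof -
    have "AE \<omega> in M. \<forall>t\<in>{a..b}. C2 (\<rho> t \<omega>)"
      using sol unfolding dmz_solution_def by blast
    then show ?thesis by eventually_elim (use sub in blast)
  qed
  moreover have "AE \<omega> in M. \<forall>x. continuous_on {a'..b'} (\<lambda>t. \<rho> t \<omega> x)"
  proof -
    have "AE \<omega> in M. \<forall>x. continuous_on {a..b} (\<lambda>t. \<rho> t \<omega> x)"
      using sol unfolding dmz_solution_def by blast
    then show ?thesis by eventually_elim (use sub continuous_on_subset in blast)
  qed
  moreover have "AE \<omega> in M. \<forall>x.
      (\<lambda>t. dual_generator f (\<rho> t \<omega>) x) absolutely_integrable_on {a'..b'}"
  proof -
    have "AE \<omega> in M. \<forall>x. (\<lambda>t. dual_generator f (\<rho> t \<omega>) x) absolutely_integrable_on {a..b}"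
      using sol unfolding dmz_solution_def by blast
    then show ?thesis
      by eventually_elim (use sub absolutely_integrable_on_subinterval in \<open>metis cbox_interval\<close>)
  qed
  moreover have "\<forall>s t x. a' \<le> s \<and> s \<le> t \<and> t \<le> b' \<longrightarrow>
        (\<exists>I. has_ito_integral M (\<lambda>u \<omega>. \<rho> u \<omega> x *\<^sub>R h x) Y s t I \<and>
             (AE \<omega> in M. \<rho> t \<omega> x =
                \<rho> s \<omega> x + integral {s..t} (\<lambda>u. dual_generator f (\<rho> u \<omega>) x) + I \<omega>))"
    using sol assms(2,3) unfolding dmz_solution_def by (meson order_trans)
  ultimately show ?thesis unfolding dmz_solution_def by blast
qed

lemma dmz_solution_continuous_in_space:
  assumes "dmz_solution M f h Y a b \<rho>"
  shows "AE \<omega> in M. \<forall>t\<in>{a..b}. continuous_on A (\<rho> t \<omega>)"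
proof -
  have "AE \<omega> in M. \<forall>t\<in>{a..b}. C2 (\<rho> t \<omega>)"
    using assms unfolding dmz_solution_def by blast
  then show ?thesis
    by eventually_elim
       (auto simp: C2_def intro!: continuous_at_imp_continuous_on differentiable_imp_continuous_within)
qed

lemma propagator_on_grids:
  assumes "T > 0"
    and sol: "dmz_solution M f h Y 0 T \<sigma>"
    and propagator: "dmz_propagator M f h Y T D P"
    and sol_D: "AE \<omega> in M. \<forall>t\<in>{0..T}. \<sigma> t \<omega> \<in> D"
  shows "AE \<omega> in M. \<forall>K k dt. T = real K * dt \<and> k < K \<longrightarrow>
    \<sigma> (real (Suc k) * dt) \<omega> = P \<omega> (real k * dt) dt (\<sigma> (real k * dt) \<omega>)"
proof -
  have "AE \<omega> in M. k < K \<longrightarrow>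
      \<sigma> (real (Suc k) * (T / real K)) \<omega>
        = P \<omega> (real k * (T / real K)) (T / real K) (\<sigma> (real k * (T / real K)) \<omega>)" for K k
  proof (cases "k < K")
    case True
    define a b where "a = real k * (T / real K)" and "b = real (Suc k) * (T / real K)"
    have "0 \<le> a" "a \<le> b"
      unfolding a_def b_def using \<open>T > 0\<close> by (simp_all add: divide_right_mono mult_right_mono)
    have "real (Suc k) * T \<le> real K * T"
      using True \<open>T > 0\<close> by (intro mult_right_mono) auto
    then have "b \<le> T"
      using True by (simp add: b_def field_simps)
    have "AE \<omega> in M. \<forall>t\<in>{a..b}. \<sigma> t \<omega> \<in> D"
      using sol_D by eventually_elim (use \<open>0 \<le> a\<close> \<open>b \<le> T\<close> in auto)
    then have "AE \<omega> in M. \<sigma> b \<omega> = P \<omega> a (b - a) (\<sigma> a \<omega>)"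
      using propagator dmz_solution_subinterval[OF sol \<open>0 \<le> a\<close> \<open>b \<le> T\<close>]
        \<open>0 \<le> a\<close> \<open>a \<le> b\<close> \<open>b \<le> T\<close>
      unfolding dmz_propagator_def by blast
    moreover have "b - a = T / real K"
      by (simp add: a_def b_def algebra_simps add_divide_distrib)
    ultimately show ?thesis
      by (simp add: a_def b_def)
  qed simp
  then have "AE \<omega> in M. \<forall>K k. k < K \<longrightarrow>
      \<sigma> (real (Suc k) * (T / real K)) \<omega>
        = P \<omega> (real k * (T / real K)) (T / real K) (\<sigma> (real k * (T / real K)) \<omega>)"
    by (simp add: AE_all_countable)
  then show ?thesis
  proof eventually_elim
    case (elim \<omega>)
    show ?case
    proof (intro allI impI)
      fix K k dt
      assume *: "T = real K * dt \<and> k < K"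
      then have "dt = T / real K" by auto
      moreover from * have "k < K" by blast
      ultimately show "\<sigma> (real (Suc k) * dt) \<omega> = P \<omega> (real k * dt) dt (\<sigma> (real k * dt) \<omega>)"
        using elim by (simp only:)
    qed
  qed
qed

section \<open>Accumulation of local errors\<close>

lemma discrete_gronwall:
  fixes E :: "nat \<Rightarrow> real"
  assumes "0 \<le> \<tau>" and "0 \<le> \<kappa>" and "E 0 \<le> 0"
    and step: "\<And>k. k < K \<Longrightarrow> E (Suc k) \<le> \<tau> + (1 + \<kappa>) * E k"
    and "k \<le> K"
  shows "E k \<le> real k * \<tau> * exp (\<kappa> * real k)"
  using \<open>k \<le> K\<close>
proof (induction k)
  case 0
  with \<open>E 0 \<le> 0\<close> show ?case by simp
next
  case (Suc k)
  have "E (Suc k) \<le> \<tau> + (1 + \<kappa>) * E k"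
    using Suc.prems by (intro step) simp
  also have "\<dots> \<le> \<tau> + (1 + \<kappa>) * (real k * \<tau> * exp (\<kappa> * real k))"
    using Suc \<open>0 \<le> \<kappa>\<close> by (intro add_left_mono mult_left_mono) auto
  also have "\<dots> \<le> \<tau> * exp (\<kappa> * real (Suc k)) + exp \<kappa> * (real k * \<tau> * exp (\<kappa> * real k))"
  proof (rule add_mono)
    have "1 \<le> exp (\<kappa> * real (Suc k))"
      using \<open>0 \<le> \<kappa>\<close> by simp
    from mult_left_mono[OF this \<open>0 \<le> \<tau>\<close>] show "\<tau> \<le> \<tau> * exp (\<kappa> * real (Suc k))" by simp
    show "(1 + \<kappa>) * (real k * \<tau> * exp (\<kappa> * real k)) \<le> exp \<kappa> * (real k * \<tau> * exp (\<kappa> * real k))"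
      using \<open>0 \<le> \<tau>\<close> by (intro mult_right_mono exp_ge_add_one_self) auto
  qed
  also have "\<dots> = real (Suc k) * \<tau> * exp (\<kappa> * real (Suc k))"
    by (simp add: algebra_simps exp_add)
  finally show ?case .
qed

text \<open>A pathwise statement: \<open>s k\<close> is the exact state at step \<open>k\<close>. It enters only through
  the local error bound and its continuity on the cube.\<close>

lemma qmc_global_error:
  fixes s :: "nat \<Rightarrow> real^'r \<Rightarrow> real" and p :: "nat \<Rightarrow> real^'r"
  assumes "R > 0" and "0 \<le> \<tau>" and "0 \<le> \<kappa>"
    and samples: "\<And>i. i \<in> {1..n} \<Longrightarrow> p i \<in> Omega R"
    and cont: "\<And>k. k \<le> K \<Longrightarrow> continuous_on (Omega R) (s k)"
    and local_error: "\<And>k. k < K \<Longrightarrow>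
      sup_norm R (\<lambda>z. s (Suc k) z - qmc_step f h dt (increment y dt k) n p (s k) z) \<le> \<tau>"
    and stability: "\<And>k. k < K \<Longrightarrow>
      op_norm R (qmc_step f h dt (increment y dt k) n p) \<le> 1 + \<kappa>"
  shows "sup_norm R (\<lambda>z. s K z - qmc_iterate f h dt y n p K (s 0) z)
    \<le> real K * \<tau> * exp (\<kappa> * real K)"
proof -
  define e where "e k = (\<lambda>z. s k z - qmc_iterate f h dt y n p k (s 0) z)" for k
  have e_Linf: "e k \<in> Linf R" if "k \<le> K" for k
    unfolding e_def using that
    by (intro continuous_on_imp_Linf continuous_on_diff continuous_on_qmc_iterate cont) auto
  have "sup_norm R (e (Suc k)) \<le> \<tau> + (1 + \<kappa>) * sup_norm R (e k)" if "k < K" for k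
  proof -
    let ?S = "qmc_step f h dt (increment y dt k) n p"
    have split: "e (Suc k) = (\<lambda>z. (s (Suc k) z - ?S (s k) z) + ?S (e k) z)"
      unfolding e_def qmc_step_diff by (simp add: fun_eq_iff)
    have "sup_norm R (e (Suc k))
        \<le> sup_norm R (\<lambda>z. s (Suc k) z - ?S (s k) z) + sup_norm R (?S (e k))"
      unfolding split
    proof (rule sup_norm_add_le[OF \<open>R > 0\<close>])
      have "(\<lambda>z. s (Suc k) z - ?S (s k) z) \<in> Linf R"
        using that by (intro continuous_on_imp_Linf continuous_on_diff continuous_on_qmc_step cont) auto
      then show "bounded ((\<lambda>z. s (Suc k) z - ?S (s k) z) ` Omega R)"
        by (simp add: Linf_def)
      have "?S (e k) \<in> Linf R"
        by (intro continuous_on_imp_Linf continuous_on_qmc_step)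
      then show "bounded (?S (e k) ` Omega R)"
        by (simp add: Linf_def)
    qed
    moreover have "sup_norm R (?S (e k)) \<le> (1 + \<kappa>) * sup_norm R (e k)"
    proof -
      have "sup_norm R (?S (e k)) \<le> op_norm R ?S * sup_norm R (e k)"
        using that by (intro sup_norm_qmc_step_le \<open>R > 0\<close> samples e_Linf) auto
      also have "\<dots> \<le> (1 + \<kappa>) * sup_norm R (e k)"
        using that e_Linf[of k] stability[OF that]
        by (intro mult_right_mono sup_norm_nonneg \<open>R > 0\<close>) (auto simp: Linf_def)
      finally show ?thesis .
    qed
    ultimately show ?thesis
      using local_error[OF that] by linarith
  qed
  moreover have "sup_norm R (e 0) \<le> 0"
    by (intro sup_norm_le[OF \<open>R > 0\<close>]) (simp add: e_def)
  ultimately have "sup_norm R (e K) \<le> real K * \<tau> * exp (\<kappa> * real K)"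
    using discrete_gronwall[OF \<open>0 \<le> \<tau>\<close> \<open>0 \<le> \<kappa>\<close>, of "\<lambda>k. sup_norm R (e k)" K K] by blast
  then show ?thesis by (simp add: e_def)
qed

section \<open>Convergence of the scheme\<close>

theorem theorem5p12:
  fixes M :: "'w measure"
    and f :: "real^'r \<Rightarrow> real^'r" and h :: "real^'r \<Rightarrow> real^'m"
    and x0 :: "'w \<Rightarrow> real^'r"
    and V X :: "real \<Rightarrow> 'w \<Rightarrow> real^'r" and W Y :: "real \<Rightarrow> 'w \<Rightarrow> real^'m"
    and \<sigma> :: "real \<Rightarrow> 'w \<Rightarrow> real^'r \<Rightarrow> real" and \<sigma>0 :: "real^'r \<Rightarrow> real"
    and D :: "(real^'r \<Rightarrow> real) set"
    and P :: "'w \<Rightarrow> real \<Rightarrow> real \<Rightarrow> (real^'r \<Rightarrow> real) \<Rightarrow> real^'r \<Rightarrow> real"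
    and x :: "nat \<Rightarrow> nat \<Rightarrow> real^'r"
    and T R C1 C2 L :: real
    and Reg :: "('w \<times> nat \<times> real) set"
  assumes "T > 0" and "R > 0"
    and f_diff: "\<And>z. f differentiable (at z)"
    and model: "filtering_model M T f h x0 V W X Y"
    and sol: "dmz_solution M f h Y 0 T \<sigma>"
    and initial: "AE \<omega> in M. \<sigma> 0 \<omega> = \<sigma>0"
    and propagator: "dmz_propagator M f h Y T D P"
    and sol_D: "AE \<omega> in M. \<forall>t\<in>{0..T}. \<sigma> t \<omega> \<in> D"
    and samples: "\<And>n i. i \<in> {1..n} \<Longrightarrow> x n i \<in> Omega R"
    and low_disc: "(\<lambda>n. sample_discrepancy R n (x n)) \<in> O(\<lambda>n. ln (real n) ^ CARD('r) / real n)"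
    and "C1 > 0" and "C2 > 0" and "L > 0"
    and local_error: "\<And>\<omega> n dt K k. \<lbrakk>(\<omega>, n, dt) \<in> Reg; n \<ge> 1; T = real K * dt; k < K\<rbrakk> \<Longrightarrow>
      sup_norm R (\<lambda>z. P \<omega> (real k * dt) dt (\<sigma> (real k * dt) \<omega>) z
          - qmc_step f h dt (increment (\<lambda>t. Y t \<omega>) dt k) n (x n) (\<sigma> (real k * dt) \<omega>) z)
        \<le> C1 * dt\<^sup>2 + C2 * sample_discrepancy R n (x n)"
    and stability: "\<And>\<omega> n dt K k. \<lbrakk>(\<omega>, n, dt) \<in> Reg; n \<ge> 1; T = real K * dt; k < K\<rbrakk> \<Longrightarrow>
      op_norm R (qmc_step f h dt (increment (\<lambda>t. Y t \<omega>) dt k) n (x n)) \<le> 1 + L * dt"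
  shows "\<exists>C3>0. AE \<omega> in M. \<forall>n dt K. (\<omega>, n, dt) \<in> Reg \<and> n \<ge> 1 \<and> T = real K * dt \<longrightarrow>
      sup_norm R (\<lambda>z. \<sigma> T \<omega> z - qmc_iterate f h dt (\<lambda>t. Y t \<omega>) n (x n) K (\<sigma> 0 \<omega>) z)
        \<le> C3 * (dt + sample_discrepancy R n (x n) / dt)"
proof -
  define C3 where "C3 = T * exp (L * T) * max C1 C2"
  have "C3 > 0"
    using \<open>T > 0\<close> \<open>C1 > 0\<close> by (simp add: C3_def less_max_iff_disj)
  from propagator_on_grids[OF \<open>T > 0\<close> sol propagator sol_D]
    dmz_solution_continuous_in_space[OF sol, where A = "Omega R"]
  have "AE \<omega> in M. \<forall>n dt K. (\<omega>, n, dt) \<in> Reg \<and> n \<ge> 1 \<and> T = real K * dt \<longrightarrow>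
      sup_norm R (\<lambda>z. \<sigma> T \<omega> z - qmc_iterate f h dt (\<lambda>t. Y t \<omega>) n (x n) K (\<sigma> 0 \<omega>) z)
        \<le> C3 * (dt + sample_discrepancy R n (x n) / dt)"
  proof eventually_elim
    case (elim \<omega>)
    show ?case
    proof (intro allI impI)
      fix n dt K
      assume "(\<omega>, n, dt) \<in> Reg \<and> n \<ge> 1 \<and> T = real K * dt"
      then have reg: "(\<omega>, n, dt) \<in> Reg" "n \<ge> 1" and T: "T = real K * dt" by auto
      have "dt > 0"
        using T \<open>T > 0\<close> by (simp add: zero_less_mult_iff)
      define d where "d = sample_discrepancy R n (x n)"
      have "d \<ge> 0"
        unfolding d_def sample_discrepancy_def by (rule star_discrepancy_nonneg)
      define \<tau> where "\<tau> = C1 * dt\<^sup>2 + C2 * d"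
      have "\<tau> \<ge> 0"
        using \<open>C1 > 0\<close> \<open>C2 > 0\<close> \<open>d \<ge> 0\<close> by (simp add: \<tau>_def)
      have cont: "continuous_on (Omega R) (\<sigma> (real k * dt) \<omega>)" if "k \<le> K" for k
      proof -
        have "real k * dt \<in> {0..T}"
          using that \<open>dt > 0\<close> by (simp add: T)
        with elim(2) show ?thesis by blast
      qed
      have "sup_norm R (\<lambda>z. \<sigma> (real K * dt) \<omega> z
            - qmc_iterate f h dt (\<lambda>t. Y t \<omega>) n (x n) K (\<sigma> (real 0 * dt) \<omega>) z)
          \<le> real K * \<tau> * exp ((L * dt) * real K)"
      proof (rule qmc_global_error[where s = "\<lambda>k. \<sigma> (real k * dt) \<omega>"])
        fix k
        assume "k < K"
        with elim(1) T
        have "\<sigma> (real (Suc k) * dt) \<omega> = P \<omega> (real k * dt) dt (\<sigma> (real k * dt) \<omega>)"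
          by blast
        with local_error[OF reg T \<open>k < K\<close>]
        show "sup_norm R (\<lambda>z. \<sigma> (real (Suc k) * dt) \<omega> z
            - qmc_step f h dt (increment (\<lambda>t. Y t \<omega>) dt k) n (x n) (\<sigma> (real k * dt) \<omega>) z) \<le> \<tau>"
          by (simp add: \<tau>_def d_def)
        show "op_norm R (qmc_step f h dt (increment (\<lambda>t. Y t \<omega>) dt k) n (x n)) \<le> 1 + L * dt"
          by (rule stability[OF reg T \<open>k < K\<close>])
      qed (use \<open>R > 0\<close> \<open>\<tau> \<ge> 0\<close> \<open>L > 0\<close> \<open>dt > 0\<close> samples cont in auto)
      also have "real K * \<tau> * exp ((L * dt) * real K) = T * exp (L * T) * (\<tau> / dt)"
        using \<open>dt > 0\<close> by (simp add: T mult_ac)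
      also have "\<tau> / dt = C1 * dt + C2 * (d / dt)"
        using \<open>dt > 0\<close> by (simp add: \<tau>_def add_divide_distrib power2_eq_square)
      also have "T * exp (L * T) * (C1 * dt + C2 * (d / dt))
          \<le> T * exp (L * T) * (max C1 C2 * dt + max C1 C2 * (d / dt))"
        using \<open>T > 0\<close> \<open>dt > 0\<close> \<open>d \<ge> 0\<close>
        by (intro mult_left_mono add_mono mult_right_mono) auto
      also have "\<dots> = C3 * (dt + d / dt)"
        by (simp add: C3_def algebra_simps)
      finally show "sup_norm R (\<lambda>z. \<sigma> T \<omega> z
            - qmc_iterate f h dt (\<lambda>t. Y t \<omega>) n (x n) K (\<sigma> 0 \<omega>) z)
          \<le> C3 * (dt + sample_discrepancy R n (x n) / dt)"
        by (simp add: T d_def)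
    qed
  qed
  with \<open>C3 > 0\<close> show ?thesis by blast
qed

end
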